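(* Let $m\in\mathbb{N}$ and let $G$ be a (countable) group. Then $G$ is of type $\mathrm{FP}_m$ if and only if there exist $K_0\ge 0$ and a chain endomorphism of $\mathbb{Z}G$-complexes $\mu_q:\mathbb{Z}[G^{q+1}]\to\mathbb{Z}[G^{q+1}]$ extending the identity on $\mathbb{Z}$ with $\operatorname{im}\mu_q\subseteq \mathrm{C}_q(\mathrm{VR}_{K_0}(G))$ for $q=0,\ldots,m$.
   Context: Countable groups are regarded as metric spaces: a finitely generated group $G$ carries the word metric $d(g,h)=l(g^{-1}h)$ with respect to a finite generating set ($l$ the word length); a countable group that is not finitely generated carries the restriction of the word metric of a finitely generated group containing it. For a metric space $X$, $k\ge 0$, $q\ge 0$, put $\Delta^q_k(X)=\{(x_0,\ldots,x_q)\in X^{q+1}\mid d(x_i,x_j)\le k \text{ for all } i,j\}$. The Vietoris--Rips complex $\mathrm{VR}_k(X)$ is the simplicial set with $q$-simplices $\Delta^q_k(X)$ (faces omit an entry, degeneracies repeat an entry). Its simplicial chain complex is $\mathrm{C}_q(\mathrm{VR}_k(X))=\mathbb{Z}[\Delta^q_k(X)]$ with $\partial_q(x_0,\ldots,x_q)=\sum_{i=0}^q(-1)^i(x_0,\ldots,\widehat{x_i},\ldots,x_q)$. For $X=G$, the group acts by diagonal left multiplication, and the $\mathrm{C}_*(\mathrm{VR}_k(G))$, $k\ge 0$, are $\mathbb{Z}G$-subcomplexes filtering the standard resolution $(\mathbb{Z}[G^{q+1}],\partial_q)_{q\ge 0}$ of the constant module $\mathbb{Z}$, whose augmentation is $\epsilon:\mathbb{Z}[G]\to\mathbb{Z}$,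 $g\mapsto 1$. A chain endomorphism $\mu$ extends the identity on $\mathbb{Z}$ if $\epsilon\circ\mu_0=\epsilon$. A direct system $(A_k)_k$ of abelian groups is essentially trivial if for every $i$ there is $j\ge i$ such that $A_i\to A_j$ is zero. A metric space $X$ is of type $\mathrm{FP}_m$ if the direct system of reduced homology groups $(\tilde{\mathrm{H}}_q(\mathrm{VR}_k(X)))_k$ (maps induced by inclusion) is essentially trivial for each $q=0,\ldots,m-1$. The group $G$ is of type $\mathrm{FP}_m$ if the metric space $(G,d)$ is. *)

theory Defs
  imports Complex_Main "HOL-Algebra.Free_Abelian_Groups" "HOL-Algebra.Generated_Groups"
begin

section \<open>Countable groups as metric spaces\<close>

definition finite_generating_set :: "('a, 'c) monoid_scheme \<Rightarrow> 'a set \<Rightarrow> bool" where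
  "finite_generating_set G S \<longleftrightarrow> finite S \<and> S \<subseteq> carrier G \<and> generate G S = carrier G"

definition word_length :: "('a, 'c) monoid_scheme \<Rightarrow> 'a set \<Rightarrow> 'a \<Rightarrow> nat" where
  "word_length G S g = (LEAST n. \<exists>ws. length ws = n
      \<and> set ws \<subseteq> S \<union> (\<lambda>s. inv\<^bsub>G\<^esub> s) ` S \<and> foldr (\<otimes>\<^bsub>G\<^esub>) ws \<one>\<^bsub>G\<^esub> = g)"

definition word_metric :: "('a, 'c) monoid_scheme \<Rightarrow> 'a set \<Rightarrow> 'a \<Rightarrow> 'a \<Rightarrow> real" where
  "word_metric G S g h = real (word_length G S (inv\<^bsub>G\<^esub> g \<otimes>\<^bsub>G\<^esub> h))"

text \<open>The metrics carried by a countable group: a word metric if the group is finitely generated,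
  otherwise the restriction of a word metric along an embedding \<open>\<phi>\<close> into a finitely generated
  group \<open>H\<close>. The type argument is the type of the elements of \<open>H\<close>, as a definition cannot quantify
  over types; statements leave it as a type variable.\<close>

definition group_metric ::
  "'b itself \<Rightarrow> ('a, 'c) monoid_scheme \<Rightarrow> ('a \<Rightarrow> 'a \<Rightarrow> real) \<Rightarrow> bool" where
  "group_metric _ G d \<longleftrightarrow>
     (if \<exists>S. finite_generating_set G S
      then \<exists>S. finite_generating_set G S
             \<and> (\<forall>g\<in>carrier G. \<forall>h\<in>carrier G. d g h = word_metric G S g h)
      else \<exists>(H :: 'b monoid) S \<phi>. group H \<and> finite_generating_set H S \<and> \<phi> \<in> mon G H
             \<and> (\<forall>g\<in>carrier G. \<forall>h\<in>carrier G. d g h = word_metric H S (\<phi> g) (\<phi> h)))"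

section \<open>Chains on tuples and Vietoris--Rips complexes\<close>

text \<open>A tuple \<open>(x\<^sub>0,\<dots>,x\<^sub>q)\<close> is a list of length \<open>q + 1\<close>; a chain is a finitely supported integral
  combination of lists.\<close>

definition tuples :: "'a set \<Rightarrow> nat \<Rightarrow> 'a list set" where
  "tuples X q = {xs. length xs = Suc q \<and> set xs \<subseteq> X}"

definition vr_simplices :: "'a set \<Rightarrow> ('a \<Rightarrow> 'a \<Rightarrow> real) \<Rightarrow> real \<Rightarrow> nat \<Rightarrow> 'a list set" where
  "vr_simplices X d k q = {xs \<in> tuples X q. \<forall>x\<in>set xs. \<forall>y\<in>set xs. d x y \<le> k}"

abbreviation vr_chains ::
  "'a set \<Rightarrow> ('a \<Rightarrow> 'a \<Rightarrow> real) \<Rightarrow> real \<Rightarrow> nat \<Rightarrow> ('a list \<Rightarrow>\<^sub>0 int) monoid" where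
  "vr_chains X d k q \<equiv> free_Abelian_group (vr_simplices X d k q)"

definition omit :: "nat \<Rightarrow> 'a list \<Rightarrow> 'a list" where
  "omit i xs = take i xs @ drop (Suc i) xs"

text \<open>To be used in degrees \<open>q \<ge> 1\<close>; in degree 0 the formula would produce the empty list.\<close>

definition bdry :: "nat \<Rightarrow> ('a list \<Rightarrow>\<^sub>0 int) \<Rightarrow> ('a list \<Rightarrow>\<^sub>0 int)" where
  "bdry q = frag_extend (\<lambda>xs. \<Sum>i\<le>q. frag_cmul ((- 1) ^ i) (frag_of (omit i xs)))"

definition augmentation :: "('b \<Rightarrow>\<^sub>0 int) \<Rightarrow> int" where
  "augmentation c = (\<Sum>x\<in>Poly_Mapping.keys c. Poly_Mapping.lookup c x)"

section \<open>Reduced homology and type FP\<close>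

definition vr_reduced_cycles ::
  "'a set \<Rightarrow> ('a \<Rightarrow> 'a \<Rightarrow> real) \<Rightarrow> real \<Rightarrow> nat \<Rightarrow> ('a list \<Rightarrow>\<^sub>0 int) set" where
  "vr_reduced_cycles X d k q =
     {c \<in> carrier (vr_chains X d k q). if q = 0 then augmentation c = 0 else bdry q c = 0}"

definition vr_boundaries ::
  "'a set \<Rightarrow> ('a \<Rightarrow> 'a \<Rightarrow> real) \<Rightarrow> real \<Rightarrow> nat \<Rightarrow> ('a list \<Rightarrow>\<^sub>0 int) set" where
  "vr_boundaries X d k q = bdry (Suc q) ` carrier (vr_chains X d k (Suc q))"

definition vr_reduced_homology ::
  "'a set \<Rightarrow> ('a \<Rightarrow> 'a \<Rightarrow> real) \<Rightarrow> nat \<Rightarrow> real \<Rightarrow> ('a list \<Rightarrow>\<^sub>0 int) set monoid" where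
  "vr_reduced_homology X d q k =
     (vr_chains X d k q\<lparr>carrier := vr_reduced_cycles X d k q\<rparr>) Mod vr_boundaries X d k q"

text \<open>The map from scale \<open>i\<close> to scale \<open>j\<close> induced by inclusion: it sends the class of a cycle \<open>z\<close>,
  that is the coset of \<open>z\<close> modulo the boundaries at scale \<open>i\<close>, to the coset of \<open>z\<close> modulo the
  boundaries at scale \<open>j\<close> (see \<open>vr_homology_map_coset\<close>).\<close>

definition vr_homology_map ::
  "'a set \<Rightarrow> ('a \<Rightarrow> 'a \<Rightarrow> real) \<Rightarrow> nat \<Rightarrow> real \<Rightarrow> real
    \<Rightarrow> ('a list \<Rightarrow>\<^sub>0 int) set \<Rightarrow> ('a list \<Rightarrow>\<^sub>0 int) set" where
  "vr_homology_map X d q i j A = vr_boundaries X d j q <#>\<^bsub>vr_chains X d j q\<^esub> A"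

text \<open>Direct systems are indexed by the real numbers \<open>k \<ge> 0\<close>.\<close>

definition essentially_trivial ::
  "(real \<Rightarrow> ('b, 'c) monoid_scheme) \<Rightarrow> (real \<Rightarrow> real \<Rightarrow> 'b \<Rightarrow> 'b) \<Rightarrow> bool" where
  "essentially_trivial A f \<longleftrightarrow>
     (\<forall>i\<ge>0. \<exists>j\<ge>i. \<forall>x\<in>carrier (A i). f i j x = \<one>\<^bsub>A j\<^esub>)"

definition type_FP :: "'a set \<Rightarrow> ('a \<Rightarrow> 'a \<Rightarrow> real) \<Rightarrow> nat \<Rightarrow> bool" where
  "type_FP X d m \<longleftrightarrow>
     (\<forall>q<m. essentially_trivial (vr_reduced_homology X d q) (vr_homology_map X d q))"

lemma bdry_diff: "bdry q (a - b) = bdry q a - bdry q b"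
  by (simp add: bdry_def frag_extend_diff)

lemma bdry_add: "bdry q (a + b) = bdry q a + bdry q b"
  by (simp add: bdry_def frag_extend_add)

lemma vr_simplices_mono: "i \<le> j \<Longrightarrow> vr_simplices X d i q \<subseteq> vr_simplices X d j q"
  by (force simp: vr_simplices_def)

lemma vr_boundaries_mono: "i \<le> j \<Longrightarrow> vr_boundaries X d i q \<subseteq> vr_boundaries X d j q"
  using vr_simplices_mono[of i j X d "Suc q"] by (auto simp: vr_boundaries_def)

lemma zero_in_vr_boundaries: "0 \<in> vr_boundaries X d k q"
  unfolding vr_boundaries_def by (rule image_eqI[of _ _ 0]) (auto simp: bdry_def)

lemma vr_boundaries_add:
  assumes "a \<in> vr_boundaries X d k q" "b \<in> vr_boundaries X d k q"
  shows "a + b \<in> vr_boundaries X d k q"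
proof -
  obtain a' b' where
    "a = bdry (Suc q) a'" "Poly_Mapping.keys a' \<subseteq> vr_simplices X d k (Suc q)"
    "b = bdry (Suc q) b'" "Poly_Mapping.keys b' \<subseteq> vr_simplices X d k (Suc q)"
    using assms by (auto simp: vr_boundaries_def)
  moreover have "Poly_Mapping.keys (a' + b') \<subseteq> vr_simplices X d k (Suc q)"
    using calculation keys_add[of a' b'] by blast
  ultimately show ?thesis
    unfolding vr_boundaries_def by (intro image_eqI[of _ _ "a' + b'"]) (auto simp: bdry_add)
qed

lemma vr_homology_map_coset:
  assumes "i \<le> j"
  shows "vr_homology_map X d q i j (vr_boundaries X d i q #>\<^bsub>vr_chains X d i q\<^esub> z)
           = vr_boundaries X d j q #>\<^bsub>vr_chains X d j q\<^esub> z" (is "?L = ?R")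
proof
  show "?L \<subseteq> ?R"
  proof
    fix y assume "y \<in> ?L"
    then obtain b a where "b \<in> vr_boundaries X d j q" "a \<in> vr_boundaries X d i q" "y = b + (a + z)"
      by (auto simp: vr_homology_map_def set_mult_def r_coset_def)
    then show "y \<in> ?R"
      using vr_boundaries_mono[OF assms, of X d q] vr_boundaries_add[of b X d j q a]
      by (auto simp: r_coset_def add.assoc intro!: bexI[of _ "b + a"])
  qed
  show "?R \<subseteq> ?L"
    using zero_in_vr_boundaries[of X d i q]
    by (force simp: vr_homology_map_def set_mult_def r_coset_def)
qed

section \<open>The standard resolution\<close>

abbreviation std_chains :: "('a, 'c) monoid_scheme \<Rightarrow> nat \<Rightarrow> ('a list \<Rightarrow>\<^sub>0 int) monoid" where
  "std_chains G q \<equiv> free_Abelian_group (tuples (carrier G) q)"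

text \<open>Scalar multiplication of the group ring \<open>\<int>G\<close>, whose elements are the elements of
  \<open>free_Abelian_group (carrier G)\<close>: the bilinear extension of diagonal left multiplication.\<close>

definition gr_smult ::
  "('a, 'c) monoid_scheme \<Rightarrow> ('a \<Rightarrow>\<^sub>0 int) \<Rightarrow> ('a list \<Rightarrow>\<^sub>0 int) \<Rightarrow> ('a list \<Rightarrow>\<^sub>0 int)" where
  "gr_smult G r c =
     frag_extend (\<lambda>g. frag_extend (\<lambda>xs. frag_of (map (\<lambda>x. g \<otimes>\<^bsub>G\<^esub> x) xs)) c) r"

definition ZG_chain_endo ::
  "('a, 'c) monoid_scheme \<Rightarrow> (nat \<Rightarrow> ('a list \<Rightarrow>\<^sub>0 int) \<Rightarrow> ('a list \<Rightarrow>\<^sub>0 int)) \<Rightarrow> bool" where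
  "ZG_chain_endo G \<mu> \<longleftrightarrow>
     (\<forall>q. \<mu> q \<in> hom (std_chains G q) (std_chains G q)
        \<and> (\<forall>r\<in>carrier (free_Abelian_group (carrier G)). \<forall>c\<in>carrier (std_chains G q).
             \<mu> q (gr_smult G r c) = gr_smult G r (\<mu> q c)))
     \<and> (\<forall>q. \<forall>c\<in>carrier (std_chains G (Suc q)).
             bdry (Suc q) (\<mu> (Suc q) c) = \<mu> q (bdry (Suc q) c))"

definition extends_identity ::
  "('a, 'c) monoid_scheme \<Rightarrow> (nat \<Rightarrow> ('a list \<Rightarrow>\<^sub>0 int) \<Rightarrow> ('a list \<Rightarrow>\<^sub>0 int)) \<Rightarrow> bool" where
  "extends_identity G \<mu> \<longleftrightarrow>
     (\<forall>c\<in>carrier (std_chains G 0). augmentation (\<mu> 0 c) = augmentation c)"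

end

(* If G is of type FP_m, then mu is built degree by degree, starting from the identity: on a free
   ZG-generator, mu_{q+1} is a filling at a larger scale of the cycle mu_q(d sigma) while q < m, and
   a cone filling afterwards.
   Conversely, comparison with the identity gives an equivariant homotopy h with
   d h z = z - mu z on cycles z. A Vietoris-Rips complex has finitely many orbits of simplices in
   each degree, because balls are finite, so h moves the scale by a bounded amount. Writing z = d w
   in the standard resolution, mu z = d (mu w) is a boundary at scale K_0, hence so is z at a scale
   independent of z. *)

theory Submission
  imports Defs
begin

section \<open>The standard complex\<close>

lemma omit_0: "omit 0 xs = tl xs"
  by (simp add: omit_def drop_Suc)

lemma omit_Suc_Cons: "omit (Suc i) (x # xs) = x # omit i xs"
  by (simp add: omit_def)

lemma omit_map: "omit i (map f xs) = map f (omit i xs)"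
  by (simp add: omit_def take_map drop_map)

lemma set_omit: "set (omit i xs) \<subseteq> set xs"
  using set_take_subset set_drop_subset by (fastforce simp: omit_def)

lemma length_omit: "i < length xs \<Longrightarrow> length (omit i xs) = length xs - 1"
  by (simp add: omit_def)

lemma bdry_of: "bdry q (frag_of xs) = (\<Sum>i\<le>q. frag_cmul ((- 1) ^ i) (frag_of (omit i xs)))"
  by (simp add: bdry_def)

lemma bdry_zero [simp]: "bdry q 0 = 0"
  by (simp add: bdry_def)

lemma keys_bdry:
  assumes "Poly_Mapping.keys c \<subseteq> tuples X (Suc q)"
  shows "Poly_Mapping.keys (bdry (Suc q) c) \<subseteq> tuples X q"
  using assms
proof (induction c rule: frag_induction)
  case (one xs)
  have "omit i xs \<in> tuples X q" if "i \<le> Suc q" for i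
    using one that set_omit[of i xs] by (auto simp: tuples_def length_omit)
  then show ?case
    unfolding bdry_of by (intro order_trans[OF keys_sum]) (auto simp: keys_frag_of)
next
  case (diff a b)
  then show ?case
    using keys_diff[of "bdry (Suc q) a" "bdry (Suc q) b"] by (auto simp: bdry_diff)
qed auto

section \<open>Coning with a fixed vertex, the contracting homotopy of the standard complex\<close>

definition cone :: "'a \<Rightarrow> ('a list \<Rightarrow>\<^sub>0 int) \<Rightarrow> ('a list \<Rightarrow>\<^sub>0 int)" where
  "cone e = frag_extend (\<lambda>xs. frag_of (e # xs))"

lemma cone_of [simp]: "cone e (frag_of xs) = frag_of (e # xs)"
  by (simp add: cone_def)

lemma cone_0 [simp]: "cone e 0 = 0"
  by (simp add: cone_def)

lemma cone_diff: "cone e (a - b) = cone e a - cone e b"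
  by (simp add: cone_def frag_extend_diff)

text \<open>Omitting the apex leaves \<open>xs\<close>; every other face keeps the apex, and its
  index is shifted by one, which flips the sign.\<close>

lemma bdry_Cons: "bdry (Suc q) (frag_of (e # xs)) = frag_of xs - cone e (bdry q (frag_of xs))"
proof -
  have "bdry (Suc q) (frag_of (e # xs))
      = frag_of xs + (\<Sum>i\<le>q. frag_cmul ((- 1) ^ Suc i) (frag_of (e # omit i xs)))"
    unfolding bdry_of sum.atMost_Suc_shift by (simp add: omit_0 omit_Suc_Cons)
  also have "(\<Sum>i\<le>q. frag_cmul ((- 1) ^ Suc i) (frag_of (e # omit i xs)))
      = - (\<Sum>i\<le>q. frag_cmul ((- 1) ^ i) (frag_of (e # omit i xs)))"
    by (simp add: sum_negf[symmetric])
  also have "(\<Sum>i\<le>q. frag_cmul ((- 1) ^ i) (frag_of (e # omit i xs)))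
      = cone e (bdry q (frag_of xs))"
    by (simp add: bdry_of cone_def frag_extend_sum frag_extend_cmul)
  finally show ?thesis by simp
qed

lemma bdry_cone: "bdry (Suc q) (cone e c) = c - cone e (bdry q c)"
proof -
  have "Poly_Mapping.keys c \<subseteq> UNIV" by simp
  then show ?thesis
    by (induction c rule: frag_induction)
       (auto simp: bdry_Cons cone_diff bdry_diff)
qed

lemma keys_cone:
  assumes "e \<in> X" "Poly_Mapping.keys c \<subseteq> tuples X q"
  shows "Poly_Mapping.keys (cone e c) \<subseteq> tuples X (Suc q)"
  using keys_frag_extend[of "\<lambda>xs. frag_of (e # xs)" c] assms
  by (fastforce simp: cone_def keys_frag_of tuples_def)

text \<open>Peeling off the first vertex replaces the usual cancellation of double faces: by
  \<open>bdry_Cons\<close> and \<open>bdry_cone\<close> everything cancels except a cone over the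
  double boundary of the shorter tuple.\<close>

lemma bdry_bdry_of:
  assumes "length xs = Suc (Suc q)"
  shows "bdry q (bdry (Suc q) (frag_of xs)) = 0"
  using assms
proof (induction q arbitrary: xs)
  case 0
  then obtain e ys where "xs = e # ys" by (cases xs) auto
  then show ?case by (simp add: bdry_of omit_0 omit_Suc_Cons bdry_diff)
next
  case (Suc q)
  then obtain e ys where xs: "xs = e # ys" "length ys = Suc (Suc q)" by (cases xs) auto
  then show ?case
    using Suc.IH[of ys] by (simp add: bdry_Cons bdry_diff bdry_cone)
qed

lemma bdry_bdry:
  assumes "Poly_Mapping.keys c \<subseteq> tuples X (Suc q)"
  shows "bdry q (bdry (Suc q) c) = 0"
  using assms
  by (induction c rule: frag_induction) (auto simp: bdry_bdry_of bdry_diff tuples_def)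

section \<open>The augmentation as the boundary in degree zero\<close>

lemma augmentation_diff: "augmentation (a - b) = augmentation a - augmentation b"
proof -
  \<comment> \<open>The three augmentations run over different supports; enlarging each to this
    common set adds only zero terms.\<close>
  let ?K = "Poly_Mapping.keys a \<union> Poly_Mapping.keys b"
  have *: "augmentation c = (\<Sum>x\<in>?K. Poly_Mapping.lookup c x)" if "Poly_Mapping.keys c \<subseteq> ?K" for c
    unfolding augmentation_def using that
    by (intro sum.mono_neutral_left) (auto simp: in_keys_iff)
  show ?thesis
    using keys_diff[of a b] by (simp add: * lookup_minus sum_subtractf)
qed

lemma augmentation_of [simp]: "augmentation (frag_of x) = 1"
  by (simp add: augmentation_def keys_frag_of)

text \<open>In degree 0 the formula for \<open>bdry\<close> yields a multiple of the empty list, so that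
  \<open>bdry 0\<close> serves as the augmentation.\<close>

lemma bdry_0:
  assumes "Poly_Mapping.keys c \<subseteq> tuples X 0"
  shows "bdry 0 c = frag_cmul (augmentation c) (frag_of [])"
  using assms
proof (induction c rule: frag_induction)
  case (one xs)
  then show ?case by (auto simp: bdry_of omit_0 tuples_def length_Suc_conv)
qed (auto simp: bdry_diff augmentation_diff frag_cmul_diff_distrib, auto simp: augmentation_def)

section \<open>Essential triviality in terms of cycles and boundaries\<close>

lemma vr_simplices_subset: "vr_simplices X d k q \<subseteq> tuples X q"
  by (auto simp: vr_simplices_def)

text \<open>Since \<open>bdry 0\<close> is the augmentation times the empty tuple, it absorbs the
  case distinction, and later inductions treat degree 0 like the others.\<close>

lemma vr_reduced_cycles_iff:
  "c \<in> vr_reduced_cycles X d k q \<longleftrightarrow> Poly_Mapping.keys c \<subseteq> vr_simplices X d k q \<and> bdry q c = 0"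
  using bdry_0[of c X] vr_simplices_subset[of X d k 0]
  by (auto simp: vr_reduced_cycles_def)

text \<open>Eliminates the quotient groups: the class of a cycle dies at scale \<open>j\<close>
  exactly when the cycle lies in the subgroup of boundaries at that scale.\<close>

lemma type_FP_iff:
  "type_FP X d m \<longleftrightarrow> (\<forall>q<m. \<forall>i\<ge>0. \<exists>j\<ge>i. vr_reduced_cycles X d i q \<subseteq> vr_boundaries X d j q)"
proof -
  have "(\<forall>x\<in>carrier (vr_reduced_homology X d q i).
            vr_homology_map X d q i j x = \<one>\<^bsub>vr_reduced_homology X d q j\<^esub>)
      \<longleftrightarrow> vr_reduced_cycles X d i q \<subseteq> vr_boundaries X d j q" if "i \<le> j" for i j q
  proof -
    let ?B = "vr_boundaries X d j q"
    have coset: "?B #>\<^bsub>vr_chains X d j q\<^esub> z = ?B \<longleftrightarrow> z \<in> ?B" for z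
    proof
      assume "?B #>\<^bsub>vr_chains X d j q\<^esub> z = ?B"
      then show "z \<in> ?B"
        using zero_in_vr_boundaries[of X d j q] by (force simp: r_coset_def)
    next
      assume z: "z \<in> ?B"
      then obtain w where "Poly_Mapping.keys w \<subseteq> vr_simplices X d j (Suc q)" "z = bdry (Suc q) w"
        by (auto simp: vr_boundaries_def)
      \<comment> \<open>Closure under negation puts \<open>b = (b - z) + z\<close> into the coset of
        \<open>z\<close>.\<close>
      then have "- z \<in> ?B"
        unfolding vr_boundaries_def
        by (intro image_eqI[of _ _ "- w"]) (auto simp: bdry_def frag_extend_minus)
      then have "b - z \<in> ?B" if "b \<in> ?B" for b
        using vr_boundaries_add[OF that, of "- z"] by simp
      then show "?B #>\<^bsub>vr_chains X d j q\<^esub> z = ?B"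
        using z vr_boundaries_add[of _ X d j q z] by (force simp: r_coset_def)
    qed
    have "carrier (vr_reduced_homology X d q i)
        = (\<lambda>z. vr_boundaries X d i q #>\<^bsub>vr_chains X d i q\<^esub> z) ` vr_reduced_cycles X d i q"
      by (simp add: vr_reduced_homology_def carrier_FactGroup r_coset_def)
    moreover have "\<one>\<^bsub>vr_reduced_homology X d q j\<^esub> = ?B"
      by (simp add: vr_reduced_homology_def)
    ultimately show ?thesis
      by (auto simp: vr_homology_map_coset[OF that] coset)
  qed
  then show ?thesis
    unfolding type_FP_def essentially_trivial_def by (metis (no_types, lifting))
qed

section \<open>Equivariant maps\<close>

text \<open>The action of a single group element on chains, that is, \<open>gr_smult\<close> by a
  basis element of the group ring.\<close>

definition translate :: "('a, 'c) monoid_scheme \<Rightarrow> 'a \<Rightarrow> ('a list \<Rightarrow>\<^sub>0 int) \<Rightarrow> ('a list \<Rightarrow>\<^sub>0 int)" where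
  "translate G g = frag_extend (\<lambda>xs. frag_of (map (\<lambda>x. g \<otimes>\<^bsub>G\<^esub> x) xs))"

lemma translate_of [simp]: "translate G g (frag_of xs) = frag_of (map (\<lambda>x. g \<otimes>\<^bsub>G\<^esub> x) xs)"
  by (simp add: translate_def)

lemma translate_diff: "translate G g (a - b) = translate G g a - translate G g b"
  by (simp add: translate_def frag_extend_diff)

lemma translate_0 [simp]: "translate G g 0 = 0"
  by (simp add: translate_def)

lemma keys_translate:
  "Poly_Mapping.keys (translate G g c) \<subseteq> map (\<lambda>x. g \<otimes>\<^bsub>G\<^esub> x) ` Poly_Mapping.keys c"
  using keys_frag_extend[of "\<lambda>xs. frag_of (map (\<lambda>x. g \<otimes>\<^bsub>G\<^esub> x) xs)" c]
  by (auto simp: translate_def keys_frag_of)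

lemma bdry_translate: "bdry q (translate G g c) = translate G g (bdry q c)"
proof -
  have "Poly_Mapping.keys c \<subseteq> UNIV" by simp
  then show ?thesis
  proof (induction c rule: frag_induction)
    case (one xs)
    then show ?case
      by (simp add: bdry_of omit_map translate_def frag_extend_sum frag_extend_cmul)
  qed (auto simp: bdry_diff translate_diff)
qed

lemma gr_smult_of: "gr_smult G (frag_of g) c = translate G g c"
  by (simp add: gr_smult_def translate_def)

text \<open>Linearity over the group ring, tested on group elements only; see
  \<open>equivariant_gr_smult\<close> for general scalars. Source and target degrees are separate so
  that boundaries and homotopies are covered too.\<close>

definition equivariant ::
  "('a, 'c) monoid_scheme \<Rightarrow> nat \<Rightarrow> nat \<Rightarrow> (('a list \<Rightarrow>\<^sub>0 int) \<Rightarrow> ('a list \<Rightarrow>\<^sub>0 int)) \<Rightarrow> bool" where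
  "equivariant G q r F \<longleftrightarrow> F \<in> hom (std_chains G q) (std_chains G r)
     \<and> (\<forall>g\<in>carrier G. \<forall>c\<in>carrier (std_chains G q). F (translate G g c) = translate G g (F c))"

lemma equivariant_keys:
  "\<lbrakk>equivariant G q r F; Poly_Mapping.keys c \<subseteq> tuples (carrier G) q\<rbrakk>
     \<Longrightarrow> Poly_Mapping.keys (F c) \<subseteq> tuples (carrier G) r"
  by (auto simp: equivariant_def hom_def Pi_def)

lemma equivariant_diff:
  assumes "equivariant G q r F" "Poly_Mapping.keys a \<subseteq> tuples (carrier G) q"
    "Poly_Mapping.keys b \<subseteq> tuples (carrier G) q"
  shows "F (a - b) = F a - F b"
  using assms by (auto simp: equivariant_def intro: hom_frag_diff)

lemma equivariant_0: "equivariant G q r F \<Longrightarrow> F 0 = 0"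
  using equivariant_diff[of G q r F 0 0] by simp

lemma equivariant_translate:
  "\<lbrakk>equivariant G q r F; g \<in> carrier G; Poly_Mapping.keys c \<subseteq> tuples (carrier G) q\<rbrakk>
     \<Longrightarrow> F (translate G g c) = translate G g (F c)"
  by (simp add: equivariant_def)

lemma equivariantI:
  assumes "\<And>c. Poly_Mapping.keys c \<subseteq> tuples (carrier G) q \<Longrightarrow> Poly_Mapping.keys (F c) \<subseteq> tuples (carrier G) r"
    and "\<And>a b. \<lbrakk>Poly_Mapping.keys a \<subseteq> tuples (carrier G) q; Poly_Mapping.keys b \<subseteq> tuples (carrier G) q\<rbrakk>
      \<Longrightarrow> F (a + b) = F a + F b"
    and "\<And>g c. \<lbrakk>g \<in> carrier G; Poly_Mapping.keys c \<subseteq> tuples (carrier G) q\<rbrakk>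
      \<Longrightarrow> F (translate G g c) = translate G g (F c)"
  shows "equivariant G q r F"
  using assms by (auto simp: equivariant_def hom_def)

lemma equivariant_add:
  assumes "equivariant G q r F" "Poly_Mapping.keys a \<subseteq> tuples (carrier G) q"
    "Poly_Mapping.keys b \<subseteq> tuples (carrier G) q"
  shows "F (a + b) = F a + F b"
  using assms by (auto simp: equivariant_def intro: hom_frag_add)

lemma equivariant_id: "equivariant G q q (\<lambda>c. c)"
  by (intro equivariantI) auto

lemma equivariant_minus:
  assumes "equivariant G q r F" "equivariant G q r F'"
  shows "equivariant G q r (\<lambda>c. F c - F' c)"
proof (rule equivariantI)
  fix c :: "'a list \<Rightarrow>\<^sub>0 int" assume "Poly_Mapping.keys c \<subseteq> tuples (carrier G) q"
  then show "Poly_Mapping.keys (F c - F' c) \<subseteq> tuples (carrier G) r"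
    using keys_diff[of "F c" "F' c"] assms[THEN equivariant_keys] by blast
qed (simp_all add: assms[THEN equivariant_add] assms[THEN equivariant_translate] translate_diff)

lemma equivariant_compose:
  assumes "equivariant G q r F" "equivariant G r s F'"
  shows "equivariant G q s (\<lambda>c. F' (F c))"
  by (intro equivariantI)
     (simp_all add: assms[THEN equivariant_add] assms[THEN equivariant_translate]
        assms[THEN equivariant_keys])

lemma equivariant_bdry: "equivariant G (Suc q) q (bdry (Suc q))"
  by (intro equivariantI) (simp_all add: bdry_add bdry_translate keys_bdry)

text \<open>Group elements generate the group ring additively, and both sides are additive in the
  scalar.\<close>

lemma equivariant_gr_smult:
  assumes F: "equivariant G q r F" and c: "Poly_Mapping.keys c \<subseteq> tuples (carrier G) q"
    and s: "Poly_Mapping.keys s \<subseteq> carrier G" and G: "group G"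
  shows "F (gr_smult G s c) = gr_smult G s (F c)"
proof -
  \<comment> \<open>The support bound travels through the induction because additivity of
    \<open>F\<close> is known only on chains of tuples in \<open>G\<close>.\<close>
  have "Poly_Mapping.keys (gr_smult G s c) \<subseteq> tuples (carrier G) q
      \<and> F (gr_smult G s c) = gr_smult G s (F c)"
    using s
  proof (induction s rule: frag_induction)
    case zero
    then show ?case using equivariant_0[OF F] by (simp add: gr_smult_def)
  next
    case (one g)
    have "Poly_Mapping.keys (translate G g c) \<subseteq> tuples (carrier G) q"
      using keys_translate[of G g c] c one G
      by (fastforce simp: tuples_def intro: group.is_monoid monoid.m_closed)
    then show ?case using equivariant_translate[OF F one c] by (simp add: gr_smult_of)
  next
    case (diff a b)
    then show ?case
      using keys_diff[of "gr_smult G a c" "gr_smult G b c"]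
        equivariant_diff[OF F, of "gr_smult G a c" "gr_smult G b c"]
      by (auto simp: gr_smult_def frag_extend_diff)
  qed
  then show ?thesis by simp
qed

section \<open>Orbits of tuples and equivariant lifts\<close>

context group
begin

abbreviation act :: "'a \<Rightarrow> 'a list \<Rightarrow> 'a list" where
  "act g \<equiv> map (\<lambda>x. g \<otimes> x)"

lemma act_in_tuples: "\<lbrakk>g \<in> carrier G; xs \<in> tuples (carrier G) q\<rbrakk> \<Longrightarrow> act g xs \<in> tuples (carrier G) q"
  by (auto simp: tuples_def)

lemma act_act:
  assumes "g \<in> carrier G" "h \<in> carrier G" "xs \<in> tuples (carrier G) q"
  shows "act g (act h xs) = act (g \<otimes> h) xs"
  using assms by (auto simp: tuples_def m_assoc)

lemma act_one: "xs \<in> tuples (carrier G) q \<Longrightarrow> act \<one> xs = xs"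
  by (rule map_idI) (auto simp: tuples_def)

lemma translate_translate:
  assumes "g \<in> carrier G" "h \<in> carrier G" "Poly_Mapping.keys c \<subseteq> tuples (carrier G) q"
  shows "translate G g (translate G h c) = translate G (g \<otimes> h) c"
  using assms(3)
proof (induction c rule: frag_induction)
  case (one xs)
  then show ?case by (simp add: act_act[OF assms(1,2) one] del: map_map)
qed (auto simp: translate_diff)

lemma hd_tuple_closed: "xs \<in> tuples (carrier G) q \<Longrightarrow> hd xs \<in> carrier G"
  by (cases xs) (auto simp: tuples_def)

text \<open>Dividing by the first entry selects a representative in the orbit of the tuple, and the
  first entry carries it back.\<close>

lemma normalised_tuple:
  assumes "xs \<in> tuples (carrier G) q"
  shows "act (inv (hd xs)) xs \<in> tuples (carrier G) q" "hd (act (inv (hd xs)) xs) = \<one>"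
    "act (hd xs) (act (inv (hd xs)) xs) = xs"
proof -
  have hd: "hd xs \<in> carrier G" and "xs \<noteq> []"
    using assms hd_tuple_closed by (auto simp: tuples_def)
  then show "act (inv (hd xs)) xs \<in> tuples (carrier G) q" "hd (act (inv (hd xs)) xs) = \<one>"
    using assms act_in_tuples by (auto simp: hd_map)
  show "act (hd xs) (act (inv (hd xs)) xs) = xs"
    using act_act[OF hd _ assms, of "inv (hd xs)"] act_one[OF assms] hd by simp
qed

text \<open>\<open>\<int>[G\<^sup>q\<^sup>+\<^sup>1]\<close> is free over \<open>\<int>G\<close> on the tuples starting with \<open>\<one>\<close>, so a lift
  may be chosen on these and extended.\<close>

lemma equivariant_lift:
  assumes P: "equivariant G q r P"
    and V: "V \<subseteq> tuples (carrier G) (Suc r)" "\<And>g xs. \<lbrakk>g \<in> carrier G; xs \<in> V\<rbrakk> \<Longrightarrow> act g xs \<in> V"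
    and lift: "\<And>xs. xs \<in> tuples (carrier G) q
      \<Longrightarrow> \<exists>w. Poly_Mapping.keys w \<subseteq> V \<and> bdry (Suc r) w = P (frag_of xs)"
  obtains F where "equivariant G q (Suc r) F"
    and "\<And>c. Poly_Mapping.keys c \<subseteq> tuples (carrier G) q
      \<Longrightarrow> Poly_Mapping.keys (F c) \<subseteq> V \<and> bdry (Suc r) (F c) = P c"
proof -
  obtain f where f: "\<And>xs. xs \<in> tuples (carrier G) q
      \<Longrightarrow> Poly_Mapping.keys (f xs) \<subseteq> V \<and> bdry (Suc r) (f xs) = P (frag_of xs)"
    using lift by metis
  \<comment> \<open>Only the values of \<open>f\<close> on tuples starting with the unit enter here;
    translation by the first entry spreads them over the orbits.\<close>
  define F where "F = frag_extend (\<lambda>xs. translate G (hd xs) (f (act (inv (hd xs)) xs)))"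
  have F_of: "F (frag_of xs) = translate G (hd xs) (f (act (inv (hd xs)) xs))" for xs
    by (simp add: F_def)
  have F_diff: "F (a - b) = F a - F b" for a b
    by (simp add: F_def frag_extend_diff)
  have F_V: "Poly_Mapping.keys (F c) \<subseteq> V \<and> bdry (Suc r) (F c) = P c"
    if "Poly_Mapping.keys c \<subseteq> tuples (carrier G) q" for c
  proof -
    have "Poly_Mapping.keys c \<subseteq> tuples (carrier G) q \<and>
        Poly_Mapping.keys (F c) \<subseteq> V \<and> bdry (Suc r) (F c) = P c"
      using that
    proof (induction c rule: frag_induction)
      case zero
      then show ?case using equivariant_0[OF P] by (simp add: F_def)
    next
      case (one xs)
      let ?ys = "act (inv (hd xs)) xs"
      have ys: "?ys \<in> tuples (carrier G) q" and hd: "hd xs \<in> carrier G"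
        and xs: "act (hd xs) ?ys = xs"
        using normalised_tuple[OF one] hd_tuple_closed[OF one] by auto
      have "Poly_Mapping.keys (F (frag_of xs)) \<subseteq> V"
        unfolding F_of using keys_translate[of G "hd xs" "f ?ys"] f[OF ys] V(2)[OF hd] by blast
      moreover have "bdry (Suc r) (F (frag_of xs)) = P (translate G (hd xs) (frag_of ?ys))"
        unfolding F_of bdry_translate using f[OF ys] equivariant_translate[OF P hd, of "frag_of ?ys"] ys
        by (simp add: keys_frag_of)
      moreover have "translate G (hd xs) (frag_of ?ys) = frag_of xs"
        unfolding translate_of xs ..
      ultimately show ?case
        using one by (simp add: keys_frag_of)
    next
      case (diff a b)
      then show ?case
        using keys_diff[of a b] keys_diff[of "F a" "F b"] equivariant_diff[OF P, of a b]
        by (auto simp: F_diff bdry_diff)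
    qed
    then show ?thesis by simp
  qed
  moreover have "equivariant G q (Suc r) F"
  proof (rule equivariantI)
    fix g and c :: "'a list \<Rightarrow>\<^sub>0 int"
    assume g: "g \<in> carrier G" and "Poly_Mapping.keys c \<subseteq> tuples (carrier G) q"
    from this(2) show "F (translate G g c) = translate G g (F c)"
    proof (induction c rule: frag_induction)
      case (one xs)
      have hd: "hd xs \<in> carrier G" "hd (act g xs) = g \<otimes> hd xs"
        using one hd_tuple_closed by (auto simp: tuples_def intro: hd_map)
      \<comment> \<open>A tuple and its translate have the same normalised representative, so their
        values under \<open>F\<close> differ only by the translation by \<open>g\<close>.\<close>
      have "act (inv (g \<otimes> hd xs)) (act g xs) = act (inv (hd xs)) xs"
        using act_act[OF _ g one, of "inv (g \<otimes> hd xs)"] g hd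
        by (simp add: inv_mult_group m_assoc)
      moreover have "Poly_Mapping.keys (f (act (inv (hd xs)) xs)) \<subseteq> tuples (carrier G) (Suc r)"
        using f normalised_tuple(1)[OF one] V(1) by blast
      ultimately show ?case
        using translate_translate[OF g hd(1)] unfolding translate_of F_of hd(2)
        by (simp del: map_map)
    qed (auto simp: F_diff translate_diff, auto simp: F_def)
  qed (use F_V V(1) in \<open>auto simp: F_def frag_extend_add\<close>)
  ultimately show thesis using that by blast
qed

section \<open>Fillings, chain endomorphisms and homotopies in the standard resolution\<close>

lemma fill_std:
  assumes "Poly_Mapping.keys c \<subseteq> tuples (carrier G) q" "bdry q c = 0"
  shows "\<exists>w. Poly_Mapping.keys w \<subseteq> tuples (carrier G) (Suc q) \<and> bdry (Suc q) w = c"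
  \<comment> \<open>The cone with apex \<open>\<one>\<close> is a filling, because the correction
    term in \<open>bdry_cone\<close> is the cone over \<open>bdry q c = 0\<close>.\<close>
  using assms keys_cone[OF one_closed assms(1)] bdry_cone[of q \<one> c]
  by (intro exI[of _ "cone \<one> c"]) simp

text \<open>The inductive construction for any invariant family \<open>V\<close> in which cycles of
  one degree bound in the next: on generators, the next map is a filling of the previous map applied
  to the boundary.\<close>

lemma chain_endo_into:
  assumes V: "\<And>q. V q \<subseteq> tuples (carrier G) q" "tuples (carrier G) 0 \<subseteq> V 0"
      "\<And>q g xs. \<lbrakk>g \<in> carrier G; xs \<in> V q\<rbrakk> \<Longrightarrow> act g xs \<in> V q"
    and fill: "\<And>q c. \<lbrakk>Poly_Mapping.keys c \<subseteq> V q; bdry q c = 0\<rbrakk>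
      \<Longrightarrow> \<exists>w. Poly_Mapping.keys w \<subseteq> V (Suc q) \<and> bdry (Suc q) w = c"
  obtains \<mu> where "ZG_chain_endo G \<mu>" "extends_identity G \<mu>"
    "\<And>q c. Poly_Mapping.keys c \<subseteq> tuples (carrier G) q \<Longrightarrow> Poly_Mapping.keys (\<mu> q c) \<subseteq> V q"
proof -
  \<comment> \<open>Preservation of cycles is part of the invariant, since it makes the image of a
    boundary fillable in the next degree.\<close>
  define P where "P q F \<longleftrightarrow> equivariant G q q F \<and> (q = 0 \<longrightarrow> F = (\<lambda>c. c))
    \<and> (\<forall>c. Poly_Mapping.keys c \<subseteq> tuples (carrier G) q \<longrightarrow>
        Poly_Mapping.keys (F c) \<subseteq> V q \<and> (bdry q c = 0 \<longrightarrow> bdry q (F c) = 0))" for q F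
  define Q where "Q q F F' \<longleftrightarrow> (\<forall>c. Poly_Mapping.keys c \<subseteq> tuples (carrier G) (Suc q) \<longrightarrow>
      bdry (Suc q) (F' c) = F (bdry (Suc q) c))" for q and F F' :: "('a list \<Rightarrow>\<^sub>0 int) \<Rightarrow> ('a list \<Rightarrow>\<^sub>0 int)"
  have "P 0 (\<lambda>c. c)"
    using V(2) by (auto simp: P_def equivariant_id)
  moreover have "\<exists>F'. P (Suc q) F' \<and> Q q F F'" if "P q F" for q F
  proof -
    have F: "equivariant G q q F"
      and FV: "\<And>c. Poly_Mapping.keys c \<subseteq> tuples (carrier G) q \<Longrightarrow> Poly_Mapping.keys (F c) \<subseteq> V q"
      and Fc: "\<And>c. \<lbrakk>Poly_Mapping.keys c \<subseteq> tuples (carrier G) q; bdry q c = 0\<rbrakk> \<Longrightarrow> bdry q (F c) = 0"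
      using that by (auto simp: P_def)
    have B: "equivariant G (Suc q) q (\<lambda>c. F (bdry (Suc q) c))"
      by (rule equivariant_compose[OF equivariant_bdry F])
    obtain F' where F': "equivariant G (Suc q) (Suc q) F'"
      "\<And>c. Poly_Mapping.keys c \<subseteq> tuples (carrier G) (Suc q)
        \<Longrightarrow> Poly_Mapping.keys (F' c) \<subseteq> V (Suc q) \<and> bdry (Suc q) (F' c) = F (bdry (Suc q) c)"
    proof (rule equivariant_lift[OF B V(1) V(3)])
      fix xs assume xs: "xs \<in> tuples (carrier G) (Suc q)"
      then have k: "Poly_Mapping.keys (frag_of xs) \<subseteq> tuples (carrier G) (Suc q)"
        by (simp add: keys_frag_of)
      show "\<exists>w. Poly_Mapping.keys w \<subseteq> V (Suc q) \<and> bdry (Suc q) w = F (bdry (Suc q) (frag_of xs))"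
        using FV[OF keys_bdry[OF k]] Fc[OF keys_bdry[OF k] bdry_bdry[OF k]] by (rule fill)
    qed auto
    \<comment> \<open>For a cycle \<open>c\<close>, the boundary of \<open>F' c\<close> is
      \<open>F 0 = 0\<close>, so cycles are again preserved.\<close>
    then have "P (Suc q) F'"
      using equivariant_0[OF F] by (auto simp: P_def)
    then show ?thesis using F'(2) by (auto simp: Q_def)
  qed
  \<comment> \<open>Dependent choice is called for because \<open>Q\<close>, the chain map equation,
    ties each map to its predecessor.\<close>
  ultimately obtain \<mu> where \<mu>: "\<And>q. P q (\<mu> q)" "\<And>q. Q q (\<mu> q) (\<mu> (Suc q))"
    using dependent_nat_choice[of P Q] by metis
  have eq: "equivariant G q q (\<mu> q)" for q
    using \<mu>(1)[of q] by (simp add: P_def)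
  have "ZG_chain_endo G \<mu>"
    using \<mu>(2) eq equivariant_gr_smult[OF eq _ _ is_group]
    by (auto simp: ZG_chain_endo_def Q_def equivariant_def)
  moreover have "extends_identity G \<mu>"
    using \<mu>(1)[of 0] by (simp add: P_def extends_identity_def)
  ultimately show thesis
    using that \<mu>(1) by (simp add: P_def)
qed

text \<open>The comparison theorem for \<open>\<mu>\<close> and the identity. Stating the homotopy
  formula on cycles only drops its term \<open>h (bdry q c)\<close>, so each degree has a statement
  of its own, strong enough for the induction.\<close>

lemma chain_endo_homotopy:
  assumes \<mu>: "ZG_chain_endo G \<mu>" "extends_identity G \<mu>"
  shows "\<exists>h. equivariant G q (Suc q) h \<and>
    (\<forall>c. Poly_Mapping.keys c \<subseteq> tuples (carrier G) q \<longrightarrow> bdry q c = 0 \<longrightarrow>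
      bdry (Suc q) (h c) = c - \<mu> q c)"
proof -
  have eq: "equivariant G q q (\<mu> q)" for q
  proof -
    have "\<mu> q (translate G g c) = translate G g (\<mu> q c)"
      if "g \<in> carrier G" "Poly_Mapping.keys c \<subseteq> tuples (carrier G) q" for g c
    proof -
      have "frag_of g \<in> carrier (free_Abelian_group (carrier G))"
        using that by simp
      then show ?thesis
        using \<mu>(1) that unfolding ZG_chain_endo_def gr_smult_of[symmetric] by simp
    qed
    then show ?thesis
      using \<mu>(1) by (simp add: ZG_chain_endo_def equivariant_def)
  qed
  have \<mu>_bdry: "bdry (Suc q) (\<mu> (Suc q) c) = \<mu> q (bdry (Suc q) c)"
    if "Poly_Mapping.keys c \<subseteq> tuples (carrier G) (Suc q)" for q c
    using \<mu>(1) that by (simp add: ZG_chain_endo_def)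
  \<comment> \<open>The standard resolution is exact, so any equivariant map with values in cycles
    lifts through the boundary.\<close>
  have step: "\<exists>h. equivariant G q (Suc q) h \<and> (\<forall>c. Poly_Mapping.keys c \<subseteq> tuples (carrier G) q \<longrightarrow>
      bdry (Suc q) (h c) = P c)"
    if P: "equivariant G q q P"
      and c: "\<And>c. Poly_Mapping.keys c \<subseteq> tuples (carrier G) q \<Longrightarrow> bdry q (P c) = 0" for P q
  proof -
    obtain h where "equivariant G q (Suc q) h"
      "\<And>c. Poly_Mapping.keys c \<subseteq> tuples (carrier G) q \<Longrightarrow>
        Poly_Mapping.keys (h c) \<subseteq> tuples (carrier G) (Suc q) \<and> bdry (Suc q) (h c) = P c"
    proof (rule equivariant_lift[OF P subset_refl act_in_tuples])
      fix xs assume "xs \<in> tuples (carrier G) q"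
      then have k: "Poly_Mapping.keys (frag_of xs) \<subseteq> tuples (carrier G) q"
        by (simp add: keys_frag_of)
      show "\<exists>w. Poly_Mapping.keys w \<subseteq> tuples (carrier G) (Suc q) \<and> bdry (Suc q) w = P (frag_of xs)"
        by (rule fill_std[OF equivariant_keys[OF P k] c[OF k]])
    qed auto
    then show ?thesis by metis
  qed
  show ?thesis
  proof (induction q)
    case 0
    have "equivariant G 0 0 (\<lambda>c. c - \<mu> 0 c)"
      by (rule equivariant_minus[OF equivariant_id eq])
    \<comment> \<open>In degree 0 being a cycle means augmentation zero, which is where
      \<open>extends_identity\<close> enters.\<close>
    moreover have "bdry 0 (c - \<mu> 0 c) = 0" if "Poly_Mapping.keys c \<subseteq> tuples (carrier G) 0" for c
      using bdry_0[OF that] bdry_0[OF equivariant_keys[OF eq that]] \<mu>(2) that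
      by (simp add: extends_identity_def bdry_diff)
    ultimately have "\<exists>h. equivariant G 0 (Suc 0) h \<and>
        (\<forall>c. Poly_Mapping.keys c \<subseteq> tuples (carrier G) 0 \<longrightarrow> bdry (Suc 0) (h c) = c - \<mu> 0 c)"
      by (rule step)
    then show ?case by blast
  next
    case (Suc q)
    then obtain h where h: "equivariant G q (Suc q) h"
      "\<And>c. \<lbrakk>Poly_Mapping.keys c \<subseteq> tuples (carrier G) q; bdry q c = 0\<rbrakk>
        \<Longrightarrow> bdry (Suc q) (h c) = c - \<mu> q c" by metis
    \<comment> \<open>The usual correction by the previous homotopy. Its values are cycles by the
      induction hypothesis at the cycle \<open>bdry (Suc q) c\<close>, and the correction vanishes
      when \<open>c\<close> is itself a cycle.\<close>
    let ?P = "\<lambda>c. c - \<mu> (Suc q) c - h (bdry (Suc q) c)"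
    have "equivariant G (Suc q) (Suc q) ?P"
      by (intro equivariant_minus equivariant_id eq equivariant_compose[OF equivariant_bdry h(1)])
    moreover have "bdry (Suc q) (?P c) = 0" if "Poly_Mapping.keys c \<subseteq> tuples (carrier G) (Suc q)" for c
      using h(2)[OF keys_bdry[OF that] bdry_bdry[OF that]] \<mu>_bdry[OF that] by (simp add: bdry_diff)
    ultimately have "\<exists>h'. equivariant G (Suc q) (Suc (Suc q)) h' \<and>
        (\<forall>c. Poly_Mapping.keys c \<subseteq> tuples (carrier G) (Suc q) \<longrightarrow> bdry (Suc (Suc q)) (h' c) = ?P c)"
      by (rule step)
    then obtain h' where h': "equivariant G (Suc q) (Suc (Suc q)) h'"
      "\<forall>c. Poly_Mapping.keys c \<subseteq> tuples (carrier G) (Suc q) \<longrightarrow> bdry (Suc (Suc q)) (h' c) = ?P c"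
      by (elim exE conjE)
    show ?case
      using h' equivariant_0[OF h(1)] by (intro exI[of _ h']) simp
  qed
qed

text \<open>Simplices at scale \<open>i\<close> form finitely many orbits, because a representative
  starting with the unit has all entries in the ball of radius \<open>i\<close>. A bound found on
  the representatives spreads by invariance of \<open>d\<close>.\<close>

lemma equivariant_bounded:
  assumes F: "equivariant G q r F"
    and inv: "\<And>g x y. \<lbrakk>g \<in> carrier G; x \<in> carrier G; y \<in> carrier G\<rbrakk> \<Longrightarrow> d (g \<otimes> x) (g \<otimes> y) = d x y"
    and balls: "\<And>k. finite {x \<in> carrier G. d \<one> x \<le> k}"
  obtains j where "\<And>c. Poly_Mapping.keys c \<subseteq> vr_simplices (carrier G) d i q
    \<Longrightarrow> Poly_Mapping.keys (F c) \<subseteq> vr_simplices (carrier G) d j r"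
proof -
  let ?C = "carrier G"
  have act_vr: "act g xs \<in> vr_simplices ?C d k n"
    if "g \<in> ?C" "xs \<in> vr_simplices ?C d k n" for g xs k n
    using that by (auto simp: vr_simplices_def tuples_def inv subset_iff)
  define R where "R = {xs \<in> vr_simplices ?C d i q. hd xs = \<one>}"
  have "R \<subseteq> {xs. set xs \<subseteq> {x \<in> ?C. d \<one> x \<le> i} \<and> length xs = Suc q}"
  proof
    fix xs assume "xs \<in> R"
    moreover from this have "\<one> \<in> set xs"
      using hd_in_set[of xs] by (force simp: R_def vr_simplices_def tuples_def)
    ultimately show "xs \<in> {xs. set xs \<subseteq> {x \<in> ?C. d \<one> x \<le> i} \<and> length xs = Suc q}"
      by (auto simp: R_def vr_simplices_def tuples_def)
  qed
  then have "finite R"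
    using finite_lists_length_eq[OF balls[of i]] by (rule finite_subset)
  \<comment> \<open>All distances inside simplices occurring in the images of the representatives;
    each image has finite support, so \<open>D\<close> is finite and has an upper bound
    \<open>j\<close>.\<close>
  define D where "D = (\<Union>xs\<in>R. \<Union>ys\<in>Poly_Mapping.keys (F (frag_of xs)).
    (\<lambda>(x, y). d x y) ` (set ys \<times> set ys))"
  have "finite D"
    using \<open>finite R\<close> by (auto simp: D_def)
  then obtain j where j: "\<And>t. t \<in> D \<Longrightarrow> t \<le> j"
    using bdd_above_finite[of D] by (auto simp: bdd_above_def)
  have R: "Poly_Mapping.keys (F (frag_of xs)) \<subseteq> vr_simplices ?C d j r" if "xs \<in> R" for xs
  proof
    fix ys assume ys: "ys \<in> Poly_Mapping.keys (F (frag_of xs))"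
    have "xs \<in> tuples ?C q"
      using that by (simp add: R_def vr_simplices_def)
    then have "ys \<in> tuples ?C r"
      using ys equivariant_keys[OF F, of "frag_of xs"] by (auto simp: keys_frag_of)
    moreover have "d x y \<in> D" if "x \<in> set ys" "y \<in> set ys" for x y
      using that ys \<open>xs \<in> R\<close> unfolding D_def by force
    ultimately show "ys \<in> vr_simplices ?C d j r"
      using j by (simp add: vr_simplices_def)
  qed
  have "Poly_Mapping.keys c \<subseteq> tuples ?C q \<and> Poly_Mapping.keys (F c) \<subseteq> vr_simplices ?C d j r"
    if "Poly_Mapping.keys c \<subseteq> vr_simplices ?C d i q" for c
    using that
  proof (induction c rule: frag_induction)
    case zero
    then show ?case using equivariant_0[OF F] by simp
  next
    case (one xs)
    then have xs: "xs \<in> tuples ?C q" by (simp add: vr_simplices_def)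
    let ?ys = "act (inv (hd xs)) xs"
    have hd: "hd xs \<in> ?C" by (rule hd_tuple_closed[OF xs])
    have "?ys \<in> R"
      using act_vr[OF _ one, of "inv (hd xs)"] hd normalised_tuple(2)[OF xs] by (simp add: R_def)
    then have "act (hd xs) ` Poly_Mapping.keys (F (frag_of ?ys)) \<subseteq> vr_simplices ?C d j r"
      using R act_vr[OF hd] by blast
    moreover have "F (frag_of xs) = translate G (hd xs) (F (frag_of ?ys))"
      using equivariant_translate[OF F hd, of "frag_of ?ys"] normalised_tuple(1,3)[OF xs]
      by (simp add: keys_frag_of del: map_map)
    ultimately show ?case
      using keys_translate[of G "hd xs" "F (frag_of ?ys)"] xs by (auto simp: keys_frag_of)
  next
    case (diff a b)
    then show ?case
      using keys_diff[of a b] keys_diff[of "F a" "F b"] equivariant_diff[OF F, of a b] by auto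
  qed
  then show thesis by (intro that[of j]) simp
qed

section \<open>The two implications for an invariant metric\<close>

lemma type_FP_if_endo:
  assumes inv: "\<And>g x y. \<lbrakk>g \<in> carrier G; x \<in> carrier G; y \<in> carrier G\<rbrakk> \<Longrightarrow> d (g \<otimes> x) (g \<otimes> y) = d x y"
    and balls: "\<And>k. finite {x \<in> carrier G. d \<one> x \<le> k}"
    and \<mu>: "ZG_chain_endo G \<mu>" "extends_identity G \<mu>"
    and bound: "\<And>q. q \<le> m \<Longrightarrow> \<mu> q ` carrier (std_chains G q) \<subseteq> carrier (vr_chains (carrier G) d K q)"
  shows "type_FP (carrier G) d m"
  unfolding type_FP_iff
proof (intro allI impI)
  fix q and i :: real assume q: "q < m" and "0 \<le> i"
  obtain h where h: "equivariant G q (Suc q) h"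
      "\<And>c. \<lbrakk>Poly_Mapping.keys c \<subseteq> tuples (carrier G) q; bdry q c = 0\<rbrakk>
        \<Longrightarrow> bdry (Suc q) (h c) = c - \<mu> q c"
    using chain_endo_homotopy[OF \<mu>, of q] by metis
  obtain j where j: "\<And>c. Poly_Mapping.keys c \<subseteq> vr_simplices (carrier G) d i q
      \<Longrightarrow> Poly_Mapping.keys (h c) \<subseteq> vr_simplices (carrier G) d j (Suc q)"
    by (rule equivariant_bounded[OF h(1) inv balls, where i = i]) auto
  \<comment> \<open>\<open>j\<close> accommodates \<open>h z\<close>, \<open>K\<close> accommodates
    the image of the filling under \<open>\<mu>\<close>, and \<open>i\<close> ensures that the new
    scale is not smaller than the old one.\<close>
  let ?J = "max i (max j K)"
  have "z \<in> vr_boundaries (carrier G) d ?J q" if z: "z \<in> vr_reduced_cycles (carrier G) d i q" for z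
  proof -
    have zi: "Poly_Mapping.keys z \<subseteq> vr_simplices (carrier G) d i q" and z0: "bdry q z = 0"
      using z by (auto simp: vr_reduced_cycles_iff)
    then have zt: "Poly_Mapping.keys z \<subseteq> tuples (carrier G) q"
      using vr_simplices_subset by blast
    \<comment> \<open>The diameters in this filling are uncontrolled; applying \<open>\<mu>\<close>
      brings it down to scale \<open>K\<close>.\<close>
    obtain w where w: "Poly_Mapping.keys w \<subseteq> tuples (carrier G) (Suc q)" "bdry (Suc q) w = z"
      using fill_std[OF zt z0] by blast
    have "\<mu> q z = bdry (Suc q) (\<mu> (Suc q) w)"
      using \<mu>(1) w by (auto simp: ZG_chain_endo_def)
    \<comment> \<open>The filling lives one degree higher, and \<open>q < m\<close> is exactly what
      puts \<open>Suc q\<close> within the range of \<open>bound\<close>.\<close>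
    moreover have "Poly_Mapping.keys (\<mu> (Suc q) w) \<subseteq> vr_simplices (carrier G) d K (Suc q)"
      using bound[of "Suc q"] q w(1) by (simp add: image_subset_iff)
    ultimately have "\<mu> q z \<in> vr_boundaries (carrier G) d K q"
      by (auto simp: vr_boundaries_def)
    moreover have "bdry (Suc q) (h z) \<in> vr_boundaries (carrier G) d j q"
      using j[OF zi] by (auto simp: vr_boundaries_def)
    ultimately have "\<mu> q z + bdry (Suc q) (h z) \<in> vr_boundaries (carrier G) d ?J q"
      by (intro vr_boundaries_add)
         (auto intro: subsetD[OF vr_boundaries_mono, of j ?J] subsetD[OF vr_boundaries_mono, of K ?J])
    then show ?thesis
      using h(2)[OF zt z0] by simp
  qed
  then show "\<exists>j\<ge>i. vr_reduced_cycles (carrier G) d i q \<subseteq> vr_boundaries (carrier G) d j q"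
    by (intro exI[of _ ?J]) auto
qed

text \<open>Applies \<open>chain_endo_into\<close> to Vietoris-Rips simplices at scales growing with
  the degree.\<close>

lemma endo_if_type_FP:
  assumes inv: "\<And>g x y. \<lbrakk>g \<in> carrier G; x \<in> carrier G; y \<in> carrier G\<rbrakk> \<Longrightarrow> d (g \<otimes> x) (g \<otimes> y) = d x y"
    and refl: "\<And>x. x \<in> carrier G \<Longrightarrow> d x x = 0"
    and FP: "type_FP (carrier G) d m"
  obtains K \<mu> where "0 \<le> K" "ZG_chain_endo G \<mu>" "extends_identity G \<mu>"
    "\<And>q. q \<le> m \<Longrightarrow> \<mu> q ` carrier (std_chains G q) \<subseteq> carrier (vr_chains (carrier G) d K q)"
proof -
  obtain J where J: "\<And>q i. \<lbrakk>q < m; 0 \<le> i\<rbrakk> \<Longrightarrow> i \<le> J q i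
      \<and> vr_reduced_cycles (carrier G) d i q \<subseteq> vr_boundaries (carrier G) d (J q i) q"
    using FP unfolding type_FP_iff by metis
  \<comment> \<open>\<open>J q (K q)\<close> is the scale at which cycles of degree \<open>q\<close>
    and scale \<open>K q\<close> bound. The maximum keeps \<open>K\<close> monotone also for
    \<open>q \<ge> m\<close>, where \<open>J\<close> is uncontrolled.\<close>
  define K where "K = rec_nat (0::real) (\<lambda>q k. max k (J q k))"
  have K: "K 0 = 0" "\<And>q. K (Suc q) = max (K q) (J q (K q))"
    by (simp_all add: K_def)
  have "mono K"
    by (simp add: mono_iff_le_Suc K)
  have K0: "0 \<le> K q" for q
    using monoD[OF \<open>mono K\<close>, of 0 q] K by simp
  define V where "V q = (if q \<le> m then vr_simplices (carrier G) d (K q) q else tuples (carrier G) q)" for q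
  have V_sub: "V q \<subseteq> tuples (carrier G) q" for q
    by (auto simp: V_def vr_simplices_def)
  \<comment> \<open>Scale 0 suffices for single vertices since \<open>d x x = 0\<close>; the
    identity is therefore allowed in degree 0.\<close>
  have "tuples (carrier G) 0 \<subseteq> V 0"
    using refl by (auto simp: V_def vr_simplices_def K tuples_def length_Suc_conv)
  moreover have "act g xs \<in> V q" if "g \<in> carrier G" "xs \<in> V q" for q g xs
    using that by (auto simp: V_def vr_simplices_def tuples_def inv subset_iff split: if_splits)
  moreover have "\<exists>w. Poly_Mapping.keys w \<subseteq> V (Suc q) \<and> bdry (Suc q) w = c"
    if c: "Poly_Mapping.keys c \<subseteq> V q" "bdry q c = 0" for q c
  proof (cases "q < m")
    case True
    then have "c \<in> vr_boundaries (carrier G) d (J q (K q)) q"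
      using c True subsetD[OF conjunct2[OF J[OF True K0]], of c q]
      by (simp add: V_def vr_reduced_cycles_iff)
    then have "c \<in> vr_boundaries (carrier G) d (K (Suc q)) q"
      using vr_boundaries_mono[of "J q (K q)" "K (Suc q)" "carrier G" d q] by (auto simp: K)
    then obtain w where "Poly_Mapping.keys w \<subseteq> vr_simplices (carrier G) d (K (Suc q)) (Suc q)"
      "c = bdry (Suc q) w"
      by (auto simp: vr_boundaries_def)
    then show ?thesis
      using True by (intro exI[of _ w]) (simp add: V_def)
  next
    case False
    then have "V (Suc q) = tuples (carrier G) (Suc q)"
      by (simp add: V_def)
    then show ?thesis
      using fill_std[OF order_trans[OF c(1) V_sub] c(2)] by simp
  qed
  ultimately obtain \<mu> where \<mu>: "ZG_chain_endo G \<mu>" "extends_identity G \<mu>"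
    "\<And>q c. Poly_Mapping.keys c \<subseteq> tuples (carrier G) q \<Longrightarrow> Poly_Mapping.keys (\<mu> q c) \<subseteq> V q"
    by (rule chain_endo_into[OF V_sub]) auto
  \<comment> \<open>By monotonicity of \<open>K\<close>, the single scale \<open>K m\<close> serves
    all degrees up to \<open>m\<close>.\<close>
  have V_le: "V q \<subseteq> vr_simplices (carrier G) d (K m) q" if "q \<le> m" for q
    using that vr_simplices_mono[OF monoD[OF \<open>mono K\<close> that]] by (auto simp: V_def)
  have "\<mu> q ` carrier (std_chains G q) \<subseteq> carrier (vr_chains (carrier G) d (K m) q)"
    if "q \<le> m" for q
    using order_trans[OF \<mu>(3) V_le[OF that]] by (simp add: image_subset_iff)
  then show thesis
    by (rule that[OF K0 \<mu>(1,2)])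
qed

end

section \<open>The metric of a countable group\<close>

text \<open>Guarantees that the minimum in \<open>word_length\<close> is attained; products are
  realised by concatenating words.\<close>

lemma (in group) word_exists:
  assumes "S \<subseteq> carrier G" "g \<in> generate G S"
  shows "\<exists>ws. set ws \<subseteq> S \<union> (\<lambda>s. inv s) ` S \<and> foldr (\<otimes>) ws \<one> = g"
  using assms(2)
proof (induction rule: generate.induct)
  case one
  then show ?case by (intro exI[of _ "[]"]) simp
next
  case (incl h)
  then show ?case using assms(1) by (intro exI[of _ "[h]"]) auto
next
  case (inv h)
  then show ?case using assms(1) by (intro exI[of _ "[inv h]"]) auto
next
  case (eng g h)
  then obtain us vs where us: "set us \<subseteq> S \<union> (\<lambda>s. inv s) ` S" "foldr (\<otimes>) us \<one> = g"
    and vs: "set vs \<subseteq> S \<union> (\<lambda>s. inv s) ` S" "foldr (\<otimes>) vs \<one> = h" by blast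
  have "S \<union> (\<lambda>s. inv s) ` S \<subseteq> carrier G" using assms(1) by auto
  then have C: "set us \<subseteq> carrier G" "set vs \<subseteq> carrier G" using us vs by blast+
  have closed: "foldr (\<otimes>) ws \<one> \<in> carrier G" if "set ws \<subseteq> carrier G" for ws
    using that by (induction ws) auto
  have h: "h \<in> carrier G" using closed[OF C(2)] vs(2) by simp
  have "foldr (\<otimes>) (ws @ vs) \<one> = foldr (\<otimes>) ws \<one> \<otimes> h" if "set ws \<subseteq> carrier G" for ws
    using that
  proof (induction ws)
    case Nil
    then show ?case using vs h by simp
  next
    case (Cons w ws)
    then show ?case using h closed[of ws] by (simp add: m_assoc)
  qed
  from this[OF C(1)] show ?case
    using us vs by (intro exI[of _ "us @ vs"]) simp
qed

text \<open>Such elements are values of words of length at most \<open>n\<close> over a finite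
  alphabet, and there are finitely many of these.\<close>

lemma (in group) finite_word_length_le:
  assumes "finite_generating_set G S"
  shows "finite {g \<in> carrier G. word_length G S g \<le> n}"
proof -
  let ?T = "S \<union> (\<lambda>s. inv s) ` S"
  have "g \<in> (\<lambda>ws. foldr (\<otimes>) ws \<one>) ` {ws. set ws \<subseteq> ?T \<and> length ws \<le> n}"
    if g: "g \<in> carrier G" "word_length G S g \<le> n" for g
  proof -
    have "\<exists>ws. set ws \<subseteq> ?T \<and> foldr (\<otimes>) ws \<one> = g"
      using assms g(1) by (intro word_exists) (auto simp: finite_generating_set_def)
    then have "\<exists>k ws. length ws = k \<and> set ws \<subseteq> ?T \<and> foldr (\<otimes>) ws \<one> = g" by simp
    then have "\<exists>ws. length ws = word_length G S g \<and> set ws \<subseteq> ?T \<and> foldr (\<otimes>) ws \<one> = g"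
      unfolding word_length_def by (rule LeastI_ex)
    then obtain ws where "length ws = word_length G S g" "set ws \<subseteq> ?T" "foldr (\<otimes>) ws \<one> = g"
      by (elim exE conjE)
    then show ?thesis
      using g(2) by (intro image_eqI[of _ _ ws]) simp_all
  qed
  then have "{g \<in> carrier G. word_length G S g \<le> n}
      \<subseteq> (\<lambda>ws. foldr (\<otimes>) ws \<one>) ` {ws. set ws \<subseteq> ?T \<and> length ws \<le> n}"
    by blast
  moreover have "finite {ws. set ws \<subseteq> ?T \<and> length ws \<le> n}"
    using assms by (intro finite_lists_length_le) (simp add: finite_generating_set_def)
  ultimately show ?thesis
    by (rule finite_subset[OF _ finite_imageI])
qed

lemma word_length_one: "word_length G S \<one>\<^bsub>G\<^esub> = 0"
  unfolding word_length_def by (rule Least_eq_0) auto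

text \<open>Left invariance holds because \<open>\<phi> g\<close> cancels against its inverse;
  finiteness of balls passes from \<open>H\<close> to \<open>G\<close> by injectivity of
  \<open>\<phi>\<close>.\<close>

lemma pulled_back_word_metric:
  assumes G: "group G" and H: "group H" and S: "finite_generating_set H S" and \<phi>: "\<phi> \<in> mon G H"
    and d: "\<And>g h. \<lbrakk>g \<in> carrier G; h \<in> carrier G\<rbrakk> \<Longrightarrow> d g h = word_metric H S (\<phi> g) (\<phi> h)"
  shows "\<lbrakk>g \<in> carrier G; x \<in> carrier G; y \<in> carrier G\<rbrakk> \<Longrightarrow> d (g \<otimes>\<^bsub>G\<^esub> x) (g \<otimes>\<^bsub>G\<^esub> y) = d x y"
    and "x \<in> carrier G \<Longrightarrow> d x x = 0"
    and "finite {x \<in> carrier G. d \<one>\<^bsub>G\<^esub> x \<le> k}"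
proof -
  interpret G: group G by fact
  interpret H: group H by fact
  interpret \<phi>: group_hom G H \<phi>
    using \<phi> by unfold_locales (auto simp: mon_def)
  show "d (g \<otimes>\<^bsub>G\<^esub> x) (g \<otimes>\<^bsub>G\<^esub> y) = d x y"
    if "g \<in> carrier G" "x \<in> carrier G" "y \<in> carrier G"
  proof -
    have "inv\<^bsub>H\<^esub> (\<phi> g \<otimes>\<^bsub>H\<^esub> \<phi> x) \<otimes>\<^bsub>H\<^esub> (\<phi> g \<otimes>\<^bsub>H\<^esub> \<phi> y)
        = inv\<^bsub>H\<^esub> \<phi> x \<otimes>\<^bsub>H\<^esub> (inv\<^bsub>H\<^esub> \<phi> g \<otimes>\<^bsub>H\<^esub> \<phi> g) \<otimes>\<^bsub>H\<^esub> \<phi> y"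
      using that by (simp only: H.inv_mult_group H.m_assoc \<phi>.hom_closed H.inv_closed H.m_closed)
    then show ?thesis
      using that by (simp add: d word_metric_def)
  qed
  show "d x x = 0" if "x \<in> carrier G"
    using that by (simp add: d word_metric_def word_length_one)
  let ?B = "{h \<in> carrier H. word_length H S h \<le> nat \<lfloor>k\<rfloor>}"
  \<comment> \<open>Word lengths are natural numbers, so a real radius may be rounded down.\<close>
  have "\<phi> ` {x \<in> carrier G. d \<one>\<^bsub>G\<^esub> x \<le> k} \<subseteq> ?B"
    by (auto simp: d word_metric_def le_nat_floor)
  then have "finite (\<phi> ` {x \<in> carrier G. d \<one>\<^bsub>G\<^esub> x \<le> k})"
    using H.finite_word_length_le[OF S] finite_subset by blast
  moreover have "inj_on \<phi> {x \<in> carrier G. d \<one>\<^bsub>G\<^esub> x \<le> k}"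
    using \<phi> by (auto simp: mon_def intro: inj_on_subset)
  ultimately show "finite {x \<in> carrier G. d \<one>\<^bsub>G\<^esub> x \<le> k}"
    by (rule finite_imageD)
qed

lemma group_metric_props:
  assumes G: "group G" and d: "group_metric TYPE('b) G d"
  shows "\<lbrakk>g \<in> carrier G; x \<in> carrier G; y \<in> carrier G\<rbrakk> \<Longrightarrow> d (g \<otimes>\<^bsub>G\<^esub> x) (g \<otimes>\<^bsub>G\<^esub> y) = d x y"
    and "x \<in> carrier G \<Longrightarrow> d x x = 0"
    and "finite {x \<in> carrier G. d \<one>\<^bsub>G\<^esub> x \<le> k}"
proof -
  \<comment> \<open>Writing the finitely generated case with \<open>id\<close> turns both cases into
    word metrics pulled back along a monomorphism.\<close>
  consider
      S where "finite_generating_set G S"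
        "\<forall>g\<in>carrier G. \<forall>h\<in>carrier G. d g h = word_metric G S (id g) (id h)"
    | H :: "'b monoid" and S \<phi> where "group H" "finite_generating_set H S" "\<phi> \<in> mon G H"
        "\<forall>g\<in>carrier G. \<forall>h\<in>carrier G. d g h = word_metric H S (\<phi> g) (\<phi> h)"
    using d unfolding group_metric_def by (auto split: if_splits)
  then have "(\<forall>g\<in>carrier G. \<forall>x\<in>carrier G. \<forall>y\<in>carrier G. d (g \<otimes>\<^bsub>G\<^esub> x) (g \<otimes>\<^bsub>G\<^esub> y) = d x y)
      \<and> (\<forall>x\<in>carrier G. d x x = 0) \<and> finite {x \<in> carrier G. d \<one>\<^bsub>G\<^esub> x \<le> k}"
  proof cases
    case (1 S)
    have "id \<in> mon G G" by (auto simp: mon_def hom_def)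
    from pulled_back_word_metric[OF G G 1(1) this, of d] 1(2) show ?thesis by blast
  next
    case (2 H S \<phi>)
    from pulled_back_word_metric[OF G 2(1-3), of d] 2(4) show ?thesis by blast
  qed
  then show "\<lbrakk>g \<in> carrier G; x \<in> carrier G; y \<in> carrier G\<rbrakk> \<Longrightarrow> d (g \<otimes>\<^bsub>G\<^esub> x) (g \<otimes>\<^bsub>G\<^esub> y) = d x y"
    and "x \<in> carrier G \<Longrightarrow> d x x = 0"
    and "finite {x \<in> carrier G. d \<one>\<^bsub>G\<^esub> x \<le> k}"
    by auto
qed

theorem theorem1:
  fixes G :: "('a, 'c) monoid_scheme" and d :: "'a \<Rightarrow> 'a \<Rightarrow> real" and m :: nat
  assumes "group G" and "countable (carrier G)" and "group_metric TYPE('b) G d"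
  shows "type_FP (carrier G) d m \<longleftrightarrow>
    (\<exists>K\<^sub>0::real. K\<^sub>0 \<ge> 0 \<and> (\<exists>\<mu>. ZG_chain_endo G \<mu> \<and> extends_identity G \<mu>
        \<and> (\<forall>q\<le>m. \<mu> q ` carrier (std_chains G q) \<subseteq> carrier (vr_chains (carrier G) d K\<^sub>0 q))))"
proof -
  note d = group_metric_props[OF assms(1,3)]
  show ?thesis
  proof
    assume FP: "type_FP (carrier G) d m"
    obtain K \<mu> where "0 \<le> K" "ZG_chain_endo G \<mu>" "extends_identity G \<mu>"
      "\<And>q. q \<le> m \<Longrightarrow> \<mu> q ` carrier (std_chains G q) \<subseteq> carrier (vr_chains (carrier G) d K q)"
      by (rule group.endo_if_type_FP[OF assms(1) _ _ FP]) (simp_all add: d)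
    then show "\<exists>K\<^sub>0::real. K\<^sub>0 \<ge> 0 \<and> (\<exists>\<mu>. ZG_chain_endo G \<mu> \<and> extends_identity G \<mu>
        \<and> (\<forall>q\<le>m. \<mu> q ` carrier (std_chains G q) \<subseteq> carrier (vr_chains (carrier G) d K\<^sub>0 q)))"
      by blast
  next
    assume "\<exists>K\<^sub>0::real. K\<^sub>0 \<ge> 0 \<and> (\<exists>\<mu>. ZG_chain_endo G \<mu> \<and> extends_identity G \<mu>
        \<and> (\<forall>q\<le>m. \<mu> q ` carrier (std_chains G q) \<subseteq> carrier (vr_chains (carrier G) d K\<^sub>0 q)))"
    then obtain K \<mu> where \<mu>: "ZG_chain_endo G \<mu>" "extends_identity G \<mu>"
      "\<And>q. q \<le> m \<Longrightarrow> \<mu> q ` carrier (std_chains G q) \<subseteq> carrier (vr_chains (carrier G) d K q)"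
      by blast
    show "type_FP (carrier G) d m"
      by (rule group.type_FP_if_endo[OF assms(1) _ _ \<mu>]) (simp_all add: d)
  qed
qed

end
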